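(* Let $p,q$ be non-negative integers with $n=p+q$ positive and let $v$ be a non-zero element of $\mathbb C^n$. Then the vector spaces $$\mathcal E_1(v)=\{\phi_{ab}:\mathrm{Sp}(p,q)\to\mathbb C\ |\ \phi_{ab}(z+jw)=\mathrm{trace}(v^taz^t+v^tbw^t),\ a,b\in\mathbb C^p_1\}$$ and $$\mathcal E_2(v)=\{\phi_{ab}:\mathrm{Sp}(p,q)\to\mathbb C\ |\ \phi_{ab}(z+jw)=\mathrm{trace}(v^taz^t+v^tbw^t),\ a,b\in\mathbb C^q_2\}$$ are eigenfamilies on $\mathrm{Sp}(p,q)$ and their union $\mathcal B=\mathcal E_1(v)\cup\mathcal E_2(v)$ is a bi-eigenfamily.
   Context: Elements of $\mathbb C^n$ are row vectors, so $v^ta$ is the $n\times n$ matrix with entries $v_ia_j$. Notation: $\mathbb C^p_1=\{(z,w)\in\mathbb C^p\times\mathbb C^q\ |\ w=0\}$ and $\mathbb C^q_2=\{(z,w)\in\mathbb C^p\times\mathbb C^q\ |\ z=0\}$, both viewed as subspaces of $\mathbb C^n$. $\mathrm{Sp}(p,q)=\{g\in\mathrm{GL}_{p+q}(\mathbb H)\ |\ gI_{pq}g^*=I_{pq}\}$ with $I_{pq}=\begin{pmatrix}-I_p&0\\0&I_q\end{pmatrix}$, regarded as a group of complex $2n\times2n$ matrices via the standard representation $z+jw\mapsto\begin{pmatrix}z&w\\-\bar w&\bar z\end{pmatrix}$, $z,w\in\mathbb C^{n\times n}$. It carries its standard left-invariant Riemannian metric, induced by the scalar product $g(Z,W)=\mathrm{Re}\,\mathrm{trace}(ZW^*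 )$ on its Lie algebra of complex $2n\times 2n$ matrices. For complex valued functions $\phi,\psi$ on a Lie group with left-invariant Riemannian metric, the Laplacian (tension field) $\tau$ and the operator $\kappa(\phi,\psi)=g(\mathrm{grad}(\phi),\mathrm{grad}(\psi))$ ($g$ extended complex bilinearly) are given by $\tau(\phi)=\sum_{Z\in\mathcal B}Z^2(\phi)$ and $\kappa(\phi,\psi)=\sum_{Z\in\mathcal B}Z(\phi)Z(\psi)$, where here $\mathcal B$ is any orthonormal basis of the Lie algebra of left-invariant vector fields, $Z(\phi)(p)=\frac{d}{ds}[\phi(p\cdot\exp(sZ))]|_{s=0}$ and $Z^2(\phi)(p)=\frac{d^2}{ds^2}[\phi(p\cdot\exp(sZ))]|_{s=0}$. A set $\mathcal E$ of complex valued functions is an eigenfamily if there exist $\lambda,\mu\in\mathbb C$ with $\tau(\phi)=\lambda\phi$ and $\kappa(\phi,\psi)=\mu\phi\psi$ for all $\phi,\psi\in\mathcal E$. The union of two non-empty eigenfamilies $\mathcal E_1,\mathcal E_2$ (with possibly different constants) is a bi-eigenfamily if there exists $\mu\in\mathbb C$ with $\kappa(\phi,\psi)=\mu\phi\psi$ for all $\phi\in\mathcal E_1$, $\psi\in\mathcal E_2$. *)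

theory Defs
  imports "HOL-Analysis.Analysis" "HOL-Library.Function_Algebras"
begin

section \<open>Left-invariant operators on matrix Lie groups\<close>

text \<open>
  \<^term>\<open>X ^ k\<close> on \<^typ>\<open>complex^'m^'m\<close> is the componentwise power, hence the iterated
  matrix product below.
\<close>
definition mexp :: "complex^'m^'m \<Rightarrow> complex^'m^'m" where
  "mexp X = (\<Sum>k. (1 / fact k) *\<^sub>R (((\<lambda>Y. X ** Y) ^^ k) (mat 1)))"

definition cadjoint :: "complex^'m^'m \<Rightarrow> complex^'m^'m" where
  "cadjoint X = (\<chi> i j. cnj (X $ j $ i))"

definition lie_algebra :: "(complex^'m^'m) set \<Rightarrow> (complex^'m^'m) set" where
  "lie_algebra G = {Z. \<forall>s::real. mexp (s *\<^sub>R Z) \<in> G}"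

definition metric :: "complex^'m^'m \<Rightarrow> complex^'m^'m \<Rightarrow> real" where
  "metric Z W = Re (trace (Z ** cadjoint W))"

definition orthonormal_basis :: "(complex^'m^'m) set \<Rightarrow> (complex^'m^'m) set \<Rightarrow> bool" where
  "orthonormal_basis G B \<longleftrightarrow>
     span B = lie_algebra G \<and> (\<forall>Z\<in>B. \<forall>W\<in>B. metric Z W = (if Z = W then 1 else 0))"

text \<open>
  A function \<open>G \<rightarrow> \<complex>\<close> is represented by a function on all matrices, of which the operators below
  use only the values on \<open>G\<close>: for \<open>x \<in> G\<close> and \<open>Z\<close> in the Lie algebra, the curve
  \<open>s \<mapsto> x exp(sZ)\<close> stays in \<open>G\<close>.
\<close>
definition deriv1 ::
  "complex^'m^'m \<Rightarrow> (complex^'m^'m \<Rightarrow> complex) \<Rightarrow> complex^'m^'m \<Rightarrow> complex" where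
  "deriv1 Z \<phi> x = vector_derivative (\<lambda>s::real. \<phi> (x ** mexp (s *\<^sub>R Z))) (at 0)"

definition deriv2 ::
  "complex^'m^'m \<Rightarrow> (complex^'m^'m \<Rightarrow> complex) \<Rightarrow> complex^'m^'m \<Rightarrow> complex" where
  "deriv2 Z \<phi> x =
     vector_derivative
       (\<lambda>s::real. vector_derivative (\<lambda>r::real. \<phi> (x ** mexp (r *\<^sub>R Z))) (at s)) (at 0)"

text \<open>
  The definite descriptions say that the value is the common value of the sum over all
  orthonormal bases; they are meaningful only if a basis exists and the sum does not depend on it.
\<close>
definition tau ::
  "(complex^'m^'m) set \<Rightarrow> (complex^'m^'m \<Rightarrow> complex) \<Rightarrow> complex^'m^'m \<Rightarrow> complex" where
  "tau G \<phi> x = (THE c. \<forall>B. orthonormal_basis G B \<longrightarrow> c = (\<Sum>Z\<in>B. deriv2 Z \<phi> x))"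

definition kappa ::
  "(complex^'m^'m) set \<Rightarrow> (complex^'m^'m \<Rightarrow> complex) \<Rightarrow> (complex^'m^'m \<Rightarrow> complex)
    \<Rightarrow> complex^'m^'m \<Rightarrow> complex" where
  "kappa G \<phi> \<psi> x =
     (THE c. \<forall>B. orthonormal_basis G B \<longrightarrow> c = (\<Sum>Z\<in>B. deriv1 Z \<phi> x * deriv1 Z \<psi> x))"

definition eigenfamily ::
  "(complex^'m^'m) set \<Rightarrow> (complex^'m^'m \<Rightarrow> complex) set \<Rightarrow> bool" where
  "eigenfamily G E \<longleftrightarrow>
     (\<exists>l \<mu>. \<forall>\<phi>\<in>E. \<forall>\<psi>\<in>E. \<forall>x\<in>G.
        tau G \<phi> x = l * \<phi> x \<and> kappa G \<phi> \<psi> x = \<mu> * \<phi> x * \<psi> x)"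

text \<open>The union \<open>E \<union> F\<close> is a bi-eigenfamily, by means of this decomposition.\<close>
definition bi_eigenfamily ::
  "(complex^'m^'m) set \<Rightarrow> (complex^'m^'m \<Rightarrow> complex) set
    \<Rightarrow> (complex^'m^'m \<Rightarrow> complex) set \<Rightarrow> bool" where
  "bi_eigenfamily G E F \<longleftrightarrow>
     E \<noteq> {} \<and> F \<noteq> {} \<and> eigenfamily G E \<and> eigenfamily G F \<and>
     (\<exists>\<mu>. \<forall>\<phi>\<in>E. \<forall>\<psi>\<in>F. \<forall>x\<in>G. kappa G \<phi> \<psi> x = \<mu> * \<phi> x * \<psi> x)"


section \<open>The group \<open>Sp(p,q)\<close> and the families\<close>

text \<open>
  Coordinates of \<open>\<complex>\<^sup>n\<close> are indexed by a linearly ordered finite type \<open>'n\<close>, of which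
  \<open>position i = 0, \<dots>, n - 1\<close> is the numbering. The first \<open>p\<close> coordinates make up \<open>\<complex>\<^sup>p\<close> and the
  remaining ones \<open>\<complex>\<^sup>q\<close>, so \<open>q = CARD('n) - p\<close> is not passed as an argument. The cases \<open>p = 0\<close>
  and \<open>q = 0\<close> are included. Complex \<open>2n \<times> 2n\<close> matrices are indexed by \<open>'n + 'n\<close>.
\<close>
definition position :: "'n::{finite,linorder} \<Rightarrow> nat" where
  "position i = card {j. j < i}"

definition Cp1 :: "nat \<Rightarrow> (complex^'n::{finite,linorder}) set" where
  "Cp1 p = {x. \<forall>i. p \<le> position i \<longrightarrow> x $ i = 0}"

definition Cq2 :: "nat \<Rightarrow> (complex^'n::{finite,linorder}) set" where
  "Cq2 p = {x. \<forall>i. position i < p \<longrightarrow> x $ i = 0}"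

definition I_pq :: "nat \<Rightarrow> complex^'n::{finite,linorder}^'n::{finite,linorder}" where
  "I_pq p = (\<chi> i j. if i = j then (if position i < p then - 1 else 1) else 0)"

text \<open>The complex \<open>2n \<times> 2n\<close> matrix with block rows \<open>z, w\<close> and \<open>- cnj w, cnj z\<close>.\<close>
definition quat_rep :: "complex^'n^'n \<Rightarrow> complex^'n^'n \<Rightarrow> complex^('n + 'n)^('n + 'n)" where
  "quat_rep z w = (\<chi> i j.
     case (i, j) of
       (Inl k, Inl l) \<Rightarrow> z $ k $ l
     | (Inl k, Inr l) \<Rightarrow> w $ k $ l
     | (Inr k, Inl l) \<Rightarrow> - cnj (w $ k $ l)
     | (Inr k, Inr l) \<Rightarrow> cnj (z $ k $ l))"

definition z_part :: "complex^('n + 'n)^('n + 'n) \<Rightarrow> complex^'n^'n" where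
  "z_part g = (\<chi> i j. g $ Inl i $ Inl j)"

definition w_part :: "complex^('n + 'n)^('n + 'n) \<Rightarrow> complex^'n^'n" where
  "w_part g = (\<chi> i j. g $ Inl i $ Inr j)"

text \<open>
  Quaternionic matrices are taken in their complex form, where the quaternionic conjugate
  transpose is the complex one and \<open>I\<^sub>p\<^sub>q\<close> is \<^term>\<open>quat_rep (I_pq p) 0\<close>.
\<close>
definition Sp :: "nat \<Rightarrow> (complex^('n::{finite,linorder} + 'n)^('n + 'n)) set" where
  "Sp p = {g. (\<exists>z w. g = quat_rep z w) \<and> invertible g \<and>
              g ** quat_rep (I_pq p) 0 ** cadjoint g = quat_rep (I_pq p) 0}"

definition outer :: "complex^'n \<Rightarrow> complex^'n \<Rightarrow> complex^'n^'n" where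
  "outer v a = (\<chi> i j. v $ i * a $ j)"

text \<open>
  Extension by zero outside \<open>Sp(p,q)\<close> makes equality and the linear structure those of
  functions on \<open>Sp(p,q)\<close>.
\<close>
definition phi ::
  "nat \<Rightarrow> complex^'n::{finite,linorder} \<Rightarrow> complex^'n::{finite,linorder} \<Rightarrow> complex^'n::{finite,linorder}
    \<Rightarrow> complex^('n + 'n)^('n + 'n) \<Rightarrow> complex" where
  "phi p v a b g =
     (if g \<in> Sp p
      then trace (outer v a ** transpose (z_part g) + outer v b ** transpose (w_part g))
      else 0)"

definition family1 ::
  "nat \<Rightarrow> complex^'n::{finite,linorder} \<Rightarrow> (complex^('n + 'n)^('n + 'n) \<Rightarrow> complex) set" where
  "family1 p v = {phi p v a b | a b. a \<in> Cp1 p \<and> b \<in> Cp1 p}"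

definition family2 ::
  "nat \<Rightarrow> complex^'n::{finite,linorder} \<Rightarrow> (complex^('n + 'n)^('n + 'n) \<Rightarrow> complex) set" where
  "family2 p v = {phi p v a b | a b. a \<in> Cq2 p \<and> b \<in> Cq2 p}"

end

theory Submission
  imports Defs
begin

text \<open>
  Every \<open>\<phi>\<close> in the two families is the restriction to \<open>Sp(p,q)\<close> of a complex linear function
  of the \<open>2n \<times> 2n\<close> matrix: with \<open>y\<close> the combination with weights \<open>v\<close> of the first \<open>n\<close> rows of \<open>x\<close>
  and \<open>c = (a, b)\<close>, one has \<open>\<phi>(x M) = y M c\<^sup>t\<close> (\<open>phi_mult_eq\<close>). Differentiating along \<open>x exp(sZ)\<close>
  gives \<open>Z(\<phi>)(x) = y Z c\<^sup>t\<close> and \<open>Z\<^sup>2(\<phi>)(x) = y Z\<^sup>2 c\<^sup>t\<close>, so that \<open>\<tau>\<close> and \<open>\<kappa>\<close> are contractions of the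
  single tensor \<open>\<Sum>\<^sub>Z Z\<^sub>i\<^sub>j Z\<^sub>k\<^sub>l\<close>, \<open>Z\<close> running over an orthonormal basis of the Lie algebra.

  The metric is the Euclidean inner product on complex matrices, and the Lie algebra is the
  common fixed space of two commuting self-adjoint conjugate-linear involutions
  (\<open>lie_algebra_Sp\<close>): one expresses that a matrix is quaternionic, the other that it is
  infinitesimally unitary for the Hermitian form. Hence the orthogonal projection onto the Lie
  algebra is the average of \<open>1\<close>, the two involutions and their product. Expanding the projected
  matrix units in the orthonormal basis evaluates the tensor (\<open>casimir_tensor\<close>) as
    \<open>(\<delta>\<^sub>i \<delta>\<^sub>j [k = i', l = j'] - \<epsilon>\<^sub>i \<epsilon>\<^sub>j [k = j, l = i]) / 2\<close>,
  where \<open>'\<close> exchanges the two halves of the index set, \<open>\<delta>\<close> is \<open>1\<close> on the first half and \<open>-1\<close> on the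
  second, and \<open>\<epsilon>\<close> is the diagonal of \<open>I\<^sub>p\<^sub>q\<close>, repeated on both halves. The two conjugate-linear
  involutions survive, while the identity and the product are complex linear and cancel between
  a matrix unit and its multiple by \<open>\<i>\<close>. The result is independent of the basis.

  In \<open>\<kappa>\<close> the first term contracts to the alternating form evaluated on \<open>(y, y)\<close>, which is zero,
  and the second to \<open>-1/2\<close> times \<open>y (\<epsilon>c)\<^sup>t * y (\<epsilon>d)\<^sup>t\<close>. On the first family \<open>\<epsilon>c = -c\<close>, on the second
  \<open>\<epsilon>c = c\<close>; so \<open>\<mu> = -1/2\<close> within either family and \<open>\<mu> = 1/2\<close> across the two. In \<open>\<tau>\<close> both terms
  are multiples of \<open>y c\<^sup>t\<close>, with \<open>\<lambda> = -(1 + 2 e (q - p)) / 2\<close> where \<open>e = -1\<close> on the first family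
  and \<open>e = 1\<close> on the second (\<open>tau_phi\<close>, \<open>kappa_phi\<close>).
\<close>

section \<open>The matrix exponential\<close>

lemma bounded_bilinear_matrix_mult:
  "bounded_bilinear ((**) :: complex^'m^'m \<Rightarrow> complex^'m^'m \<Rightarrow> complex^'m^'m)"
proof -
  have "bilinear ((**) :: complex^'m^'m \<Rightarrow> complex^'m^'m \<Rightarrow> complex^'m^'m)"
    unfolding bilinear_def
    by (auto intro!: linearI simp: vec_eq_iff matrix_matrix_mult_def algebra_simps
        sum.distrib scaleR_sum_right)
  then show ?thesis by (simp add: bilinear_conv_bounded_bilinear)
qed

interpretation matmul: bounded_bilinear "(**) :: complex^'m^'m \<Rightarrow> complex^'m^'m \<Rightarrow> complex^'m^'m"
  by (rule bounded_bilinear_matrix_mult)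

abbreviation mpow :: "complex^'m^'m \<Rightarrow> nat \<Rightarrow> complex^'m^'m" where
  "mpow X k \<equiv> ((\<lambda>Y. X ** Y) ^^ k) (mat 1)"

lemma mpow_scaleR: "mpow (s *\<^sub>R X) k = s ^ k *\<^sub>R mpow X k"
  by (induction k) (simp_all add: matmul.scaleR_left matmul.scaleR_right)

lemma mpow_commute: "mpow X k ** X = X ** mpow X k"
  by (induction k) (simp_all flip: matrix_mul_assoc)

lemma norm_mpow_bound:
  fixes X :: "complex^'m^'m"
  obtains K where "\<And>k. norm (mpow X k) \<le> K ^ k * norm (mat 1 :: complex^'m^'m)"
proof -
  obtain K where K: "K \<ge> 0" "\<And>(A::complex^'m^'m) (B::complex^'m^'m). norm (A ** B) \<le> norm A * norm B * K"
    using bounded_bilinear.nonneg_bounded[OF bounded_bilinear_matrix_mult[where 'm='m]] by blast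
  have "norm (mpow X k) \<le> (norm X * K) ^ k * norm (mat 1 :: complex^'m^'m)" for k
  proof (induction k)
    case (Suc k)
    have "norm (mpow X (Suc k)) \<le> norm X * K * norm (mpow X k)"
      using K(2)[of X "mpow X k"] by (simp add: mult_ac)
    also have "\<dots> \<le> norm X * K * ((norm X * K) ^ k * norm (mat 1 :: complex^'m^'m))"
      using Suc K(1) by (intro mult_left_mono) auto
    finally show ?case by (simp add: mult_ac)
  qed auto
  then show thesis by (rule that)
qed

lemma summable_mexp:
  fixes X :: "complex^'m^'m"
  shows "summable (\<lambda>k. (1 / fact k) *\<^sub>R mpow X k)"
proof -
  obtain K where K: "\<And>k. norm (mpow X k) \<le> K ^ k * norm (mat 1 :: complex^'m^'m)"
    using norm_mpow_bound by blast
  have le: "norm ((1 / fact k) *\<^sub>R mpow X k) \<le> inverse (fact k) * K ^ k * norm (mat 1 :: complex^'m^'m)" for k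
    using K[of k] by (simp add: field_simps)
  have sm: "summable (\<lambda>k. inverse (fact k) * K ^ k * norm (mat 1 :: complex^'m^'m))"
    using summable_exp[of K] by (rule summable_mult2)
  show ?thesis by (rule summable_comparison_test'[OF sm, where N=0]) (rule le)
qed

text \<open>
  Used with multiplications, conjugations and coordinate functions for \<open>f\<close>: identities for all
  powers of \<open>X\<close> pass to the exponential.
\<close>
lemma bounded_linear_mexp:
  assumes "bounded_linear f"
  shows "f (mexp X) = (\<Sum>k. (1 / fact k) *\<^sub>R f (mpow X k))"
  using bounded_linear.suminf[OF assms summable_mexp]
  by (simp add: mexp_def linear_scale[OF bounded_linear.linear[OF assms]])

lemma mexp_commute: "mexp X ** X = X ** mexp X"
  unfolding bounded_linear_mexp[OF matmul.bounded_linear_left]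
    bounded_linear_mexp[OF matmul.bounded_linear_right] mpow_commute ..

lemma mexp_zero [simp]: "mexp 0 = (mat 1 :: complex^'m^'m)"
proof -
  have mpow_0: "mpow (0 :: complex^'m^'m) k = (if k = 0 then mat 1 else 0)" for k
    by (cases k) auto
  then have "mexp (0 :: complex^'m^'m) = (\<Sum>k. if k = 0 then mat 1 else 0)"
    unfolding mexp_def mpow_0 by (intro suminf_cong) auto
  also have "\<dots> = mat 1" using sums_single[of 0 "\<lambda>_. mat 1 :: complex^'m^'m"]
    by (simp add: sums_iff)
  finally show ?thesis .
qed

lemma has_vector_derivative_matrixI:
  fixes F :: "real \<Rightarrow> complex^'m^'k"
  assumes "\<And>i j. ((\<lambda>s. F s $ i $ j) has_vector_derivative D $ i $ j) (at x within S)"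
  shows "(F has_vector_derivative D) (at x within S)"
  using assms unfolding has_vector_derivative_def has_derivative_def
  by (auto intro!: vec_tendstoI bounded_linear_scaleR_left)

text \<open>
  Each entry is a complex power series in the parameter that converges everywhere, so it may be
  differentiated term by term; the differentiated series is the entry of the product because left
  multiplication by \<open>X\<close> is continuous.
\<close>
lemma mexp_has_vector_derivative:
  fixes X :: "complex^'m^'m"
  shows "((\<lambda>s. mexp (s *\<^sub>R X)) has_vector_derivative X ** mexp (s *\<^sub>R X)) (at s)"
proof (rule has_vector_derivative_matrixI)
  fix i j
  define c where "c k = mpow X k $ i $ j / fact k" for k
  have bl: "bounded_linear (\<lambda>Y :: complex^'m^'m. Y $ i $ j)"
    by (intro bounded_linear_compose[OF bounded_linear_vec_nth bounded_linear_vec_nth])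
  have E: "mexp (r *\<^sub>R X) $ i $ j = (\<Sum>k. c k * of_real r ^ k)" for r
    unfolding bounded_linear_mexp[OF bl] c_def mpow_scaleR
    by (intro suminf_cong) (simp add: scaleR_conv_of_real[where 'a=complex] mult_ac)
  obtain K where K: "\<And>k. norm (mpow X k) \<le> K ^ k * norm (mat 1 :: complex^'m^'m)"
    using norm_mpow_bound by blast
  have sm: "summable (\<lambda>k. c k * y ^ k)" for y
  proof (rule summable_comparison_test'[where N=0])
    show "summable (\<lambda>k. inverse (fact k) * (K * norm y) ^ k * norm (mat 1 :: complex^'m^'m))"
      using summable_exp by (rule summable_mult2)
    fix k :: nat
    have "norm (mpow X k $ i $ j) \<le> norm (mpow X k)"
      by (meson Finite_Cartesian_Product.norm_nth_le order_trans)
    with K[of k] have "norm (mpow X k $ i $ j) \<le> K ^ k * norm (mat 1 :: complex^'m^'m)" by linarith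
    from mult_right_mono[OF this, of "inverse (fact k) * norm y ^ k"]
    show "norm (c k * y ^ k) \<le> inverse (fact k) * (K * norm y) ^ k * norm (mat 1 :: complex^'m^'m)"
      by (simp add: c_def norm_mult norm_divide norm_power power_mult_distrib norm_inverse divide_inverse mult_ac)
  qed
  have bl': "bounded_linear (\<lambda>Y :: complex^'m^'m. (X ** Y) $ i $ j)"
    by (rule bounded_linear_compose[OF bl matmul.bounded_linear_right])
  have D: "(X ** mexp (s *\<^sub>R X)) $ i $ j = (\<Sum>k. diffs c k * of_real s ^ k)"
    unfolding bounded_linear_mexp[OF bl'] diffs_def c_def mpow_scaleR
    by (intro suminf_cong)
      (simp add: scaleR_conv_of_real[where 'a=complex] matmul.scaleR_right field_simps del: of_nat_Suc)
  show "((\<lambda>s. mexp (s *\<^sub>R X) $ i $ j) has_vector_derivative (X ** mexp (s *\<^sub>R X)) $ i $ j) (at s)"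
    unfolding E D
    by (rule has_vector_derivative_real_field)
      (rule termdiffs_strong_converges_everywhere[OF sm])
qed

section \<open>The group as a fixed-point set\<close>

definition flip :: "'n + 'n \<Rightarrow> 'n + 'n" where
  "flip = case_sum Inr Inl"

definition qsign :: "'n + 'n \<Rightarrow> complex" where
  "qsign = case_sum (\<lambda>_. 1) (\<lambda>_. - 1)"

text \<open>
  The diagonal of the Hermitian form that defines \<open>Sp(p,q)\<close>.
\<close>
definition psign :: "nat \<Rightarrow> 'n::{finite,linorder} + 'n \<Rightarrow> complex" where
  "psign p = case_sum (\<lambda>i. I_pq p $ i $ i) (\<lambda>i. I_pq p $ i $ i)"

lemma flip_simps [simp]: "flip (Inl i) = Inr i" "flip (Inr i) = Inl i" "flip (flip k) = k"
  by (auto simp: flip_def split: sum.split)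

lemma flip_eq_iff [simp]: "flip k = flip l \<longleftrightarrow> k = l"
  by (metis flip_simps(3))

lemma flip_swap: "flip k = l \<longleftrightarrow> k = flip l"
  by (metis flip_simps(3))

lemma bij_flip: "bij flip"
  by (metis flip_simps(3) bijI')

lemma sum_flip: "(\<Sum>k\<in>UNIV. f (flip k)) = (\<Sum>k\<in>UNIV. f k)"
  using sum.reindex_bij_betw[OF bij_flip] .

lemma sum_UNIV_Plus:
  "(\<Sum>k\<in>UNIV. f k) = (\<Sum>i\<in>UNIV. f (Inl i)) + (\<Sum>i\<in>UNIV. f (Inr i))"
  for f :: "'a::finite + 'b::finite \<Rightarrow> 'c::comm_monoid_add"
  using sum.Plus[of UNIV UNIV f] by (simp add: comp_def)

lemma qsign_simps [simp]:
  "qsign (Inl i) = 1" "qsign (Inr i) = - 1" "qsign (flip k) = - qsign k"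
  "cnj (qsign k) = qsign k" "qsign k * qsign k = 1" "qsign k * (qsign k * c) = c"
  by (auto simp: qsign_def flip_def split: sum.split)

lemma psign_cases: "psign p k = 1 \<or> psign p k = - 1"
  by (auto simp: psign_def I_pq_def split: sum.split)

lemma psign_simps [simp]:
  "psign p (flip k) = psign p k"
  "cnj (psign p k) = psign p k" "psign p k * psign p k = 1" "psign p k * (psign p k * c) = c"
  by (use psign_cases[of p k] in \<open>auto simp: psign_def flip_def split: sum.split\<close>)

lemma form_nth: "quat_rep (I_pq p) 0 $ k $ l = (if k = l then psign p k else 0)"
  by (cases k; cases l) (auto simp: quat_rep_def psign_def I_pq_def)

lemma mult_form_nth: "(X ** quat_rep (I_pq p) 0) $ k $ l = X $ k $ l * psign p l"
  by (simp add: matrix_matrix_mult_def form_nth if_distrib cong: if_cong)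

lemma form_mult_nth: "(quat_rep (I_pq p) 0 ** X) $ k $ l = psign p k * X $ k $ l"
  by (simp add: matrix_matrix_mult_def form_nth if_distrib[of "\<lambda>x. x * _"] cong: if_cong)

lemma form_square: "quat_rep (I_pq p) 0 ** quat_rep (I_pq p) 0 = mat 1"
  by (simp add: vec_eq_iff form_mult_nth form_nth mat_def)

text \<open>
  \<open>X \<mapsto> \<Omega> cnj(X) \<Omega>\<^sup>-\<^sup>1\<close> for the standard symplectic matrix \<open>\<Omega>\<close>; the matrices fixed by it are the
  quaternionic ones.
\<close>
definition quat_conj :: "complex^('n + 'n)^('n + 'n) \<Rightarrow> complex^('n::finite + 'n)^('n + 'n)" where
  "quat_conj X = (\<chi> k l. qsign k * qsign l * cnj (X $ flip k $ flip l))"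

text \<open>
  \<open>X \<mapsto> - J X\<^sup>* J\<close> for \<open>J = quat_rep (I_pq p) 0\<close>, written out in entries.
\<close>
definition sp_conj ::
  "nat \<Rightarrow> complex^('n + 'n)^('n + 'n) \<Rightarrow> complex^('n::{finite,linorder} + 'n)^('n + 'n)" where
  "sp_conj p X = (\<chi> k l. - (psign p k * psign p l * cnj (X $ l $ k)))"

lemma quat_rep_iff: "(\<exists>z w. g = quat_rep z w) \<longleftrightarrow> quat_conj g = g"
proof
  assume "\<exists>z w. g = quat_rep z w"
  then show "quat_conj g = g"
    by (auto simp: vec_eq_iff quat_conj_def quat_rep_def flip_def qsign_def split: sum.split)
next
  assume "quat_conj g = g"
  then have "qsign k * qsign l * cnj (g $ flip k $ flip l) = g $ k $ l" for k l
    by (simp add: vec_eq_iff quat_conj_def)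
  note * = this[of "Inr _" "Inl _"] this[of "Inr _" "Inr _"]
  have "g = quat_rep (z_part g) (w_part g)"
    unfolding vec_eq_iff
    by (intro allI; case_tac i; case_tac ia)
      (use * in \<open>auto simp: quat_rep_def z_part_def w_part_def\<close>)
  then show "\<exists>z w. g = quat_rep z w" by blast
qed

lemma quat_conj_mult: "quat_conj (X ** Y) = quat_conj X ** quat_conj Y"
proof -
  have "(\<Sum>m\<in>UNIV. X $ flip k $ m * Y $ m $ flip l) =
      (\<Sum>m\<in>UNIV. X $ flip k $ flip m * Y $ flip m $ flip l)" for k l
    by (rule sum_flip[symmetric])
  then show ?thesis
    by (simp add: vec_eq_iff quat_conj_def matrix_matrix_mult_def sum_distrib_left mult_ac)
qed

lemma quat_conj_mat_1 [simp]: "quat_conj (mat 1) = mat 1"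
  by (auto simp: vec_eq_iff quat_conj_def mat_def)

lemma cadjoint_mult: "cadjoint (X ** Y) = cadjoint Y ** cadjoint X"
  by (simp add: vec_eq_iff cadjoint_def matrix_matrix_mult_def cnj_sum mult.commute)

lemma cadjoint_mat_1 [simp]: "cadjoint (mat 1) = mat 1"
  by (simp add: vec_eq_iff cadjoint_def mat_def)

lemma bounded_linear_quat_conj: "bounded_linear quat_conj"
  unfolding linear_conv_bounded_linear[symmetric]
  by (rule linearI) (auto simp: vec_eq_iff quat_conj_def algebra_simps)

lemma bounded_linear_sp_conj: "bounded_linear (sp_conj p)"
  unfolding linear_conv_bounded_linear[symmetric]
  by (rule linearI) (auto simp: vec_eq_iff sp_conj_def algebra_simps)

lemma bounded_linear_cadjoint: "bounded_linear cadjoint"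
  unfolding linear_conv_bounded_linear[symmetric]
  by (rule linearI) (auto simp: vec_eq_iff cadjoint_def)

text \<open>
  Invertibility follows from the invariance of the form: as \<open>J\<^sup>2 = 1\<close>, the matrix \<open>J g\<^sup>* J\<close> is a right
  inverse of \<open>g\<close>.
\<close>
lemma Sp_iff:
  "g \<in> Sp p \<longleftrightarrow>
     quat_conj g = g \<and> g ** quat_rep (I_pq p) 0 ** cadjoint g = quat_rep (I_pq p) 0"
proof -
  have "invertible g" if "g ** quat_rep (I_pq p) 0 ** cadjoint g = quat_rep (I_pq p) 0"
  proof -
    have "g ** (quat_rep (I_pq p) 0 ** cadjoint g ** quat_rep (I_pq p) 0) = mat 1"
      using that by (simp add: matrix_mul_assoc form_square)
    then show ?thesis using invertible_right_inverse by blast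
  qed
  then show ?thesis by (auto simp: Sp_def quat_rep_iff)
qed

lemma Sp_mult: "g \<in> Sp p \<Longrightarrow> h \<in> Sp p \<Longrightarrow> g ** h \<in> Sp p"
  unfolding Sp_iff cadjoint_mult quat_conj_mult by (metis matrix_mul_assoc)

lemma sp_conj_fixed_iff:
  "sp_conj p Z = Z \<longleftrightarrow>
     Z ** quat_rep (I_pq p) 0 + quat_rep (I_pq p) 0 ** cadjoint Z = 0" (is "_ \<longleftrightarrow> ?R")
proof -
  have "- (psign p k * psign p l * cnj (Z $ l $ k)) = Z $ k $ l \<longleftrightarrow>
     Z $ k $ l * psign p l + psign p k * cnj (Z $ l $ k) = 0" for k l
  proof -
    have "Z $ k $ l * psign p l + psign p k * cnj (Z $ l $ k) =
        psign p l * (psign p k * psign p l * cnj (Z $ l $ k) + Z $ k $ l)"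
      by (simp add: distrib_left mult_ac)
    moreover have "psign p l \<noteq> 0" using psign_cases[of p l] by auto
    ultimately show ?thesis by (simp add: neg_eq_iff_add_eq_0)
  qed
  then show ?thesis
    by (simp add: vec_eq_iff sp_conj_def mult_form_nth form_mult_nth cadjoint_def)
qed

text \<open>
  With \<open>E\<close> the one-parameter group of \<open>Z\<close>, the derivative of \<open>E J E\<^sup>*\<close> is \<open>E (Z J + J Z\<^sup>*) E\<^sup>*\<close>. If \<open>E\<close> stays
  in the group, evaluating at \<open>0\<close> gives \<open>Z J + J Z\<^sup>* = 0\<close>; conversely this equation makes \<open>E J E\<^sup>*\<close>
  constant. The quaternionic condition is linear, multiplicative and closed, so it passes from \<open>Z\<close>
  to \<open>E\<close> along the series and from \<open>E\<close> to \<open>Z\<close> by differentiation.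
\<close>
lemma lie_algebra_Sp: "lie_algebra (Sp p) = {Z. quat_conj Z = Z \<and> sp_conj p Z = Z}"
proof (intro set_eqI iffI CollectI)
  fix Z :: "complex^('n::{finite,linorder} + 'n)^('n + 'n)"
  let ?J = "quat_rep (I_pq p) 0 :: complex^('n + 'n)^('n + 'n)"
  let ?E = "\<lambda>s::real. mexp (s *\<^sub>R Z)"
  have E': "(?E has_vector_derivative ?E s ** Z) (at s)" for s
  proof -
    have "?E s ** Z = Z ** ?E s"
      by (cases "s = 0")
        (use mexp_commute[of "s *\<^sub>R Z"] in \<open>simp_all add: matmul.scaleR_left matmul.scaleR_right\<close>)
    then show ?thesis using mexp_has_vector_derivative[of Z s] by simp
  qed
  have adj': "((\<lambda>s. cadjoint (?E s)) has_vector_derivative cadjoint Z ** cadjoint (?E s)) (at s)" for s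
    using bounded_linear.has_vector_derivative[OF bounded_linear_cadjoint E'[of s]]
    by (simp add: cadjoint_mult)
  have EJE': "((\<lambda>s. ?E s ** ?J ** cadjoint (?E s)) has_vector_derivative
      ?E s ** (Z ** ?J + ?J ** cadjoint Z) ** cadjoint (?E s)) (at s)" for s
  proof -
    have "((\<lambda>s. ?E s ** ?J) has_vector_derivative ?E s ** Z ** ?J) (at s)"
      by (rule bounded_linear.has_vector_derivative[OF matmul.bounded_linear_left E'])
    from matmul.has_vector_derivative[OF this adj']
    show ?thesis
      by (simp add: matmul.add_left matmul.add_right matrix_mul_assoc add.commute)
  qed
  {
    assume "Z \<in> lie_algebra (Sp p)"
    then have S: "?E s \<in> Sp p" for s by (simp add: lie_algebra_def)
    have "((\<lambda>s. quat_conj (?E s)) has_vector_derivative quat_conj Z) (at 0)"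
      using bounded_linear.has_vector_derivative[OF bounded_linear_quat_conj E'[of 0]] by simp
    moreover have "quat_conj (?E s) = ?E s" for s using S[of s] by (simp add: Sp_iff)
    ultimately have "quat_conj Z = Z"
      using vector_derivative_unique_at[OF _ E'[of 0]] by simp
    moreover have "Z ** ?J + ?J ** cadjoint Z = 0"
      using vector_derivative_unique_at[OF EJE'[of 0], of 0] S by (simp add: Sp_iff)
    ultimately show "quat_conj Z = Z \<and> sp_conj p Z = Z" by (simp add: sp_conj_fixed_iff)
  next
    assume "Z \<in> {Z. quat_conj Z = Z \<and> sp_conj p Z = Z}"
    then have Z: "quat_conj Z = Z" "Z ** ?J + ?J ** cadjoint Z = 0"
      by (auto simp: sp_conj_fixed_iff)
    have "mexp (s *\<^sub>R Z) \<in> Sp p" for s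
    proof -
      have "quat_conj (mpow (s *\<^sub>R Z) k) = mpow (s *\<^sub>R Z) k" for k
        using Z(1) by (induction k)
          (simp_all add: quat_conj_mult linear_scale[OF bounded_linear.linear[OF bounded_linear_quat_conj]])
      then have "quat_conj (?E s) = ?E s"
        unfolding bounded_linear_mexp[OF bounded_linear_quat_conj] by (simp add: mexp_def)
      moreover obtain c where c: "\<And>s. ?E s ** ?J ** cadjoint (?E s) = c"
        using has_vector_derivative_zero_constant[of UNIV "\<lambda>s. ?E s ** ?J ** cadjoint (?E s)"] EJE' Z(2)
        by auto
      from c[of 0] have "c = ?J" by simp
      ultimately show ?thesis using c[of s] by (simp add: Sp_iff)
    qed
    then show "Z \<in> lie_algebra (Sp p)" by (simp add: lie_algebra_def)
  }
qed

section \<open>Orthonormal bases and the Casimir tensor\<close>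

lemma metric_eq_inner: "metric Z W = Z \<bullet> W"
  by (simp add: metric_def inner_vec_def trace_def matrix_matrix_mult_def cadjoint_def
      inner_complex_def)

lemma sp_conj_selfadjoint: "sp_conj p X \<bullet> Y = X \<bullet> sp_conj p Y"
proof -
  have "sp_conj p X \<bullet> Y = (\<Sum>l\<in>UNIV. \<Sum>k\<in>UNIV. sp_conj p X $ k $ l \<bullet> Y $ k $ l)"
    unfolding inner_vec_def by (rule sum.swap)
  also have "\<dots> = X \<bullet> sp_conj p Y"
    unfolding inner_vec_def
  proof (intro sum.cong refl)
    show "sp_conj p X $ k $ l \<bullet> Y $ k $ l = X $ l $ k \<bullet> sp_conj p Y $ l $ k" for k l
      using psign_cases[of p k] psign_cases[of p l]
      by (auto simp: sp_conj_def inner_complex_def)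
  qed
  finally show ?thesis .
qed

lemma quat_conj_selfadjoint: "quat_conj X \<bullet> Y = X \<bullet> quat_conj Y"
proof -
  have "quat_conj X \<bullet> Y = (\<Sum>k\<in>UNIV. \<Sum>l\<in>UNIV. quat_conj X $ flip k $ flip l \<bullet> Y $ flip k $ flip l)"
    unfolding inner_vec_def
    unfolding sum_flip[of "\<lambda>k. \<Sum>l\<in>UNIV. quat_conj X $ k $ flip l \<bullet> Y $ k $ flip l"]
    by (intro sum.cong refl sum_flip[symmetric])
  also have "\<dots> = X \<bullet> quat_conj Y"
    unfolding inner_vec_def
  proof (intro sum.cong refl)
    show "quat_conj X $ flip k $ flip l \<bullet> Y $ flip k $ flip l = X $ k $ l \<bullet> quat_conj Y $ k $ l" for k l
      by (cases k; cases l) (auto simp: quat_conj_def inner_complex_def)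
  qed
  finally show ?thesis .
qed

lemma sp_conj_sp_conj [simp]: "sp_conj p (sp_conj p X) = X"
  by (simp add: vec_eq_iff sp_conj_def mult.assoc mult.left_commute)

lemma quat_conj_quat_conj [simp]: "quat_conj (quat_conj X) = X"
  by (simp add: vec_eq_iff quat_conj_def mult.assoc mult.left_commute)

lemma sp_conj_quat_conj: "sp_conj p (quat_conj X) = quat_conj (sp_conj p X)"
  by (simp add: vec_eq_iff sp_conj_def quat_conj_def mult_ac)

text \<open>
  The orthogonal projection onto the Lie algebra: the average over the group of order four
  generated by two commuting self-adjoint involutions.
\<close>
definition lie_proj ::
  "nat \<Rightarrow> complex^('n + 'n)^('n + 'n) \<Rightarrow> complex^('n::{finite,linorder} + 'n)^('n + 'n)" where
  "lie_proj p X = (1/4) *\<^sub>R (X + sp_conj p X + quat_conj X + sp_conj p (quat_conj X))"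

lemmas sp_conj_linear = bounded_linear.linear[OF bounded_linear_sp_conj]
lemmas quat_conj_linear = bounded_linear.linear[OF bounded_linear_quat_conj]

lemma lie_proj_in_lie_algebra: "lie_proj p X \<in> lie_algebra (Sp p)"
  unfolding lie_algebra_Sp
  by (simp add: lie_proj_def linear_scale[OF sp_conj_linear] linear_add[OF sp_conj_linear]
      linear_scale[OF quat_conj_linear] linear_add[OF quat_conj_linear]
      sp_conj_quat_conj[symmetric] add_ac)

lemma inner_lie_proj:
  assumes "Z \<in> lie_algebra (Sp p)"
  shows "lie_proj p X \<bullet> Z = X \<bullet> Z"
  using assms unfolding lie_algebra_Sp
  by (simp add: lie_proj_def inner_add_left sp_conj_selfadjoint quat_conj_selfadjoint)

lemma subspace_lie_algebra: "subspace (lie_algebra (Sp p))"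
  unfolding lie_algebra_Sp subspace_def
  by (simp add: linear_scale[OF sp_conj_linear] linear_add[OF sp_conj_linear]
      linear_scale[OF quat_conj_linear] linear_add[OF quat_conj_linear]
      linear_0[OF sp_conj_linear] linear_0[OF quat_conj_linear])

lemma orthonormal_basis_exists:
  "\<exists>B :: (complex^('n::{finite,linorder} + 'n)^('n + 'n)) set. orthonormal_basis (Sp p) B"
proof -
  obtain B :: "(complex^('n + 'n)^('n + 'n)) set" where B: "B \<subseteq> lie_algebra (Sp p)" "pairwise orthogonal B" "\<And>x. x \<in> B \<Longrightarrow> norm x = 1"
      "span B = lie_algebra (Sp p)"
    using orthonormal_basis_subspace[OF subspace_lie_algebra[of p]] by metis
  then have "orthonormal_basis (Sp p) B"
    by (auto simp: orthonormal_basis_def metric_eq_inner norm_eq_1 pairwise_def orthogonal_def)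
  then show ?thesis ..
qed

lemma orthonormal_basisD:
  assumes "orthonormal_basis G B"
  shows "finite B" "B \<subseteq> lie_algebra G" "pairwise orthogonal B" "\<And>Z. Z \<in> B \<Longrightarrow> norm Z = 1"
    "span B = lie_algebra G"
proof -
  have B: "span B = lie_algebra G" "\<forall>Z\<in>B. \<forall>W\<in>B. Z \<bullet> W = (if Z = W then 1 else 0)"
    using assms by (auto simp: orthonormal_basis_def metric_eq_inner)
  then show "B \<subseteq> lie_algebra G" "span B = lie_algebra G" using span_superset by blast+
  show *: "pairwise orthogonal B" "\<And>Z. Z \<in> B \<Longrightarrow> norm Z = 1"
    using B(2) by (auto simp: pairwise_def orthogonal_def norm_eq_1)
  then show "finite B" using pairwise_orthogonal_imp_finite by blast
qed

text \<open>
  Write an entry as \<open>Z\<^sub>i\<^sub>j = \<langle>E, Z\<rangle> + \<i> \<langle>\<i>E, Z\<rangle>\<close> with \<open>E\<close> the matrix unit at \<open>(i, j)\<close>. Since the projection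
  \<open>P\<close> is self-adjoint and fixes \<open>Z\<close>, the sum \<open>\<Sum>\<^sub>Z Z\<^sub>i\<^sub>j Z\<close> equals \<open>P(E) + \<i> P(\<i>E)\<close>, which refers to no
  basis. The complex linear terms of \<open>P\<close> contribute \<open>1 + \<i>\<^sup>2 = 0\<close>, the conjugate-linear ones are doubled.
\<close>
lemma casimir_tensor:
  assumes "orthonormal_basis (Sp p) B"
  shows "(\<Sum>Z\<in>B. Z $ i $ j * Z $ k $ l) =
    (if k = flip i \<and> l = flip j then qsign i * qsign j / 2 else 0)
    - (if k = j \<and> l = i then psign p i * psign p j / 2 else 0)"
proof -
  note B = orthonormal_basisD[OF assms]
  define E where "E c = (\<chi> k l. if k = i \<and> l = j then c else 0)" for c :: complex
  have inner_E: "E c \<bullet> Z = c \<bullet> Z $ i $ j" for c Z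
  proof -
    have "E c \<bullet> Z = (\<Sum>k\<in>UNIV. if k = i then (\<Sum>l\<in>UNIV. if l = j then c \<bullet> Z $ k $ l else 0) else 0)"
      unfolding inner_vec_def E_def
      by (intro sum.cong refl) (auto intro!: sum.cong simp del: sum.delta sum.delta')
    then show ?thesis by simp
  qed
  have expand: "lie_proj p (E c) = (\<Sum>Z\<in>B. (c \<bullet> Z $ i $ j) *\<^sub>R Z)" for c
  proof -
    have "(\<Sum>Z\<in>B. (lie_proj p (E c) \<bullet> Z) *\<^sub>R Z) = lie_proj p (E c)"
      using B by (intro orthonormal_basis_expand) (auto simp: lie_proj_in_lie_algebra)
    also have "(\<Sum>Z\<in>B. (lie_proj p (E c) \<bullet> Z) *\<^sub>R Z) = (\<Sum>Z\<in>B. (c \<bullet> Z $ i $ j) *\<^sub>R Z)"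
      using B(2) by (intro sum.cong refl) (auto simp: inner_lie_proj inner_E)
    finally show ?thesis by simp
  qed
  have "(\<Sum>Z\<in>B. Z $ i $ j * Z $ k $ l) = lie_proj p (E 1) $ k $ l + \<i> * lie_proj p (E \<i>) $ k $ l"
    unfolding expand sum_component vector_scaleR_component sum_distrib_left sum.distrib[symmetric]
    by (intro sum.cong refl) (simp add: inner_complex_def complex_eq_iff)
  also have "\<dots> = (if k = flip i \<and> l = flip j then qsign i * qsign j / 2 else 0)
    - (if k = j \<and> l = i then psign p i * psign p j / 2 else 0)"
  proof -
    have sp: "sp_conj p X $ k $ l = - (psign p k * psign p l * cnj (X $ l $ k))" for X
      by (simp add: sp_conj_def)
    have qc: "quat_conj X $ k $ l = qsign k * qsign l * cnj (X $ flip k $ flip l)" for X k l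
      by (simp add: quat_conj_def)
    have E: "E c $ k $ l = c * E 1 $ k $ l" "cnj (E 1 $ k $ l) = E 1 $ k $ l" for c k l
      by (simp_all add: E_def)
    have proj: "lie_proj p (E c) $ k $ l = (c * E 1 $ k $ l - psign p k * psign p l * (cnj c * E 1 $ l $ k)
        + qsign k * qsign l * (cnj c * E 1 $ flip k $ flip l)
        - psign p k * psign p l * (qsign l * qsign k * (c * E 1 $ flip l $ flip k))) / 4" for c
      unfolding lie_proj_def vector_scaleR_component vector_add_component sp qc
      by (subst (1 2 3 4) E(1)) (simp add: E(2) scaleR_conv_of_real)
    have "lie_proj p (E 1) $ k $ l + \<i> * lie_proj p (E \<i>) $ k $ l =
        qsign k * qsign l * E 1 $ flip k $ flip l / 2 - psign p k * psign p l * E 1 $ l $ k / 2"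
      unfolding proj by (simp add: field_simps)
    also have "qsign k * qsign l * E 1 $ flip k $ flip l / 2 =
        (if k = flip i \<and> l = flip j then qsign i * qsign j / 2 else 0)"
      by (auto simp: E_def flip_swap)
    also have "psign p k * psign p l * E 1 $ l $ k / 2 =
        (if k = j \<and> l = i then psign p i * psign p j / 2 else 0)"
      by (simp add: E_def)
    finally show ?thesis .
  qed
  finally show ?thesis .
qed

lemma sum_delta_pair:
  fixes f :: "'a::finite \<Rightarrow> 'a \<Rightarrow> complex"
  shows "(\<Sum>k\<in>UNIV. \<Sum>l\<in>UNIV. f k l * (if k = a \<and> l = b then c else 0)) = f a b * c"
proof -
  have "(\<Sum>k\<in>UNIV. \<Sum>l\<in>UNIV. f k l * (if k = a \<and> l = b then c else 0)) =
    (\<Sum>k\<in>UNIV. if k = a then (\<Sum>l\<in>UNIV. if l = b then f k l * c else 0) else 0)"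
    by (intro sum.cong refl) (auto intro!: sum.cong simp del: sum.delta sum.delta')
  also have "\<dots> = f a b * c" by (simp only: sum.delta finite UNIV_I if_True)
  finally show ?thesis .
qed

text \<open>
  The contraction of an arbitrary coefficient array with the Casimir tensor, of which the sums
  defining \<open>\<kappa>\<close> and \<open>\<tau>\<close> are instances.
\<close>
lemma casimir_sum:
  assumes "orthonormal_basis (Sp p) B"
  shows "(\<Sum>Z\<in>B. \<Sum>i\<in>UNIV. \<Sum>j\<in>UNIV. \<Sum>k\<in>UNIV. \<Sum>l\<in>UNIV. F i j k l * (Z $ i $ j * Z $ k $ l)) =
    (\<Sum>i\<in>UNIV. \<Sum>j\<in>UNIV. F i j (flip i) (flip j) * (qsign i * qsign j / 2)
      - F i j j i * (psign p i * psign p j / 2))"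
proof -
  have "(\<Sum>Z\<in>B. \<Sum>i\<in>UNIV. \<Sum>j\<in>UNIV. \<Sum>k\<in>UNIV. \<Sum>l\<in>UNIV. F i j k l * (Z $ i $ j * Z $ k $ l)) =
    (\<Sum>i\<in>UNIV. \<Sum>j\<in>UNIV. \<Sum>k\<in>UNIV. \<Sum>l\<in>UNIV. F i j k l * (\<Sum>Z\<in>B. Z $ i $ j * Z $ k $ l))"
    unfolding sum_distrib_left
    by (subst sum.swap, intro sum.cong refl)+
  also have "\<dots> = (\<Sum>i\<in>UNIV. \<Sum>j\<in>UNIV. F i j (flip i) (flip j) * (qsign i * qsign j / 2)
      - F i j j i * (psign p i * psign p j / 2))"
    unfolding casimir_tensor[OF assms] right_diff_distrib sum_subtractf sum_delta_pair ..
  finally show ?thesis .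
qed

section \<open>Derivatives of the functions\<close>

definition coef :: "complex^'n \<Rightarrow> complex^'n \<Rightarrow> 'n + 'n \<Rightarrow> complex" where
  "coef a b = case_sum (($) a) (($) b)"

definition row_comb :: "complex^'n \<Rightarrow> complex^('n + 'n)^('n + 'n) \<Rightarrow> 'n::finite + 'n \<Rightarrow> complex" where
  "row_comb v g j = (\<Sum>k\<in>UNIV. v $ k * g $ Inl k $ j)"

definition pairing :: "('m \<Rightarrow> complex) \<Rightarrow> complex^'m^'m \<Rightarrow> ('m::finite \<Rightarrow> complex) \<Rightarrow> complex" where
  "pairing y M c = (\<Sum>i\<in>UNIV. \<Sum>j\<in>UNIV. y i * M $ i $ j * c j)"

lemma phi_eq:
  assumes "g \<in> Sp p"
  shows "phi p v a b g = (\<Sum>j\<in>UNIV. row_comb v g j * coef a b j)"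
proof -
  have "phi p v a b g = (\<Sum>k\<in>UNIV. (\<Sum>j\<in>UNIV. v $ k * a $ j * g $ Inl k $ Inl j)
      + (\<Sum>j\<in>UNIV. v $ k * b $ j * g $ Inl k $ Inr j))"
    using assms
    by (simp add: phi_def trace_def outer_def matrix_matrix_mult_def transpose_def
        z_part_def w_part_def)
  also have "\<dots> = (\<Sum>k\<in>UNIV. \<Sum>j\<in>UNIV. v $ k * g $ Inl k $ j * coef a b j)"
    by (intro sum.cong refl) (simp add: sum_UNIV_Plus coef_def mult_ac)
  also have "\<dots> = (\<Sum>j\<in>UNIV. row_comb v g j * coef a b j)"
    unfolding row_comb_def sum_distrib_right by (rule sum.swap)
  finally show ?thesis .
qed

lemma row_comb_mult: "row_comb v (x ** M) j = (\<Sum>i\<in>UNIV. row_comb v x i * M $ i $ j)"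
  unfolding row_comb_def matrix_matrix_mult_def vec_lambda_beta sum_distrib_left sum_distrib_right
  by (subst sum.swap) (simp add: mult_ac)

lemma phi_mult_eq:
  assumes "x ** M \<in> Sp p"
  shows "phi p v a b (x ** M) = pairing (row_comb v x) M (coef a b)"
  unfolding phi_eq[OF assms] row_comb_mult pairing_def sum_distrib_right
  by (rule sum.swap)

lemma bounded_linear_pairing: "bounded_linear (\<lambda>M. pairing y M c)"
  unfolding linear_conv_bounded_linear[symmetric] pairing_def
  by (rule linearI) (auto simp: algebra_simps sum.distrib scaleR_sum_right)

text \<open>
  Off the group \<open>phi\<close> is zero and hence not linear; the curve stays in the group, where it
  agrees with a linear function of the exponential.
\<close>
lemma phi_along_exp:
  assumes "x \<in> Sp p" "Z \<in> lie_algebra (Sp p)"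
  shows "phi p v a b (x ** mexp (s *\<^sub>R Z)) = pairing (row_comb v x) (mexp (s *\<^sub>R Z)) (coef a b)"
  using assms by (intro phi_mult_eq Sp_mult) (auto simp: lie_algebra_def)

lemma vector_derivative_pairing_exp:
  "vector_derivative (\<lambda>s. pairing y (A ** mexp (s *\<^sub>R Z)) c) (at s) = pairing y (A ** (Z ** mexp (s *\<^sub>R Z))) c"
proof (rule vector_derivative_at)
  show "((\<lambda>s. pairing y (A ** mexp (s *\<^sub>R Z)) c) has_vector_derivative
      pairing y (A ** (Z ** mexp (s *\<^sub>R Z))) c) (at s)"
    by (intro bounded_linear.has_vector_derivative[OF bounded_linear_pairing]
        bounded_linear.has_vector_derivative[OF matmul.bounded_linear_right]
        mexp_has_vector_derivative)
qed

lemma deriv1_phi: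
  assumes "x \<in> Sp p" "Z \<in> lie_algebra (Sp p)"
  shows "deriv1 Z (phi p v a b) x = pairing (row_comb v x) Z (coef a b)"
  using vector_derivative_pairing_exp[of "row_comb v x" "mat 1" Z "coef a b" 0]
  by (simp add: deriv1_def phi_along_exp[OF assms])

lemma deriv2_phi:
  assumes "x \<in> Sp p" "Z \<in> lie_algebra (Sp p)"
  shows "deriv2 Z (phi p v a b) x = pairing (row_comb v x) (Z ** Z) (coef a b)"
  using vector_derivative_pairing_exp[of "row_comb v x" "mat 1" Z "coef a b"]
    vector_derivative_pairing_exp[of "row_comb v x" Z Z "coef a b" 0]
  by (simp add: deriv2_def phi_along_exp[OF assms])

section \<open>The operators on the two families\<close>

text \<open>
  The alternating form with matrix \<open>\<Omega>\<close> vanishes on \<open>(y, y)\<close>: the terms at \<open>i\<close> and \<open>flip i\<close> cancel.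
\<close>
lemma qsign_antisymmetric:
  fixes y :: "'n::finite + 'n \<Rightarrow> complex"
  shows "(\<Sum>i\<in>UNIV. qsign i * y i * y (flip i)) = 0"
  by (simp add: sum_UNIV_Plus mult_ac sum_negf)

text \<open>
  The coefficient vectors are eigenvectors of the diagonal matrix \<open>psign p\<close>, with eigenvalue
  \<open>-1\<close> for the first family and \<open>1\<close> for the second; allowing two eigenvalues covers the mixed case
  needed for the union.
\<close>
lemma sum_orthonormal_deriv1:
  assumes "orthonormal_basis (Sp p) B" "x \<in> Sp p"
    and a: "\<And>j. psign p j * coef a b j = e * coef a b j"
    and a': "\<And>j. psign p j * coef a' b' j = e' * coef a' b' j"
  shows "(\<Sum>Z\<in>B. deriv1 Z (phi p v a b) x * deriv1 Z (phi p v a' b') x) =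
    - (e * e' / 2) * phi p v a b x * phi p v a' b' x"
proof -
  define y c d where "y = row_comb v x" and "c = coef a b" and "d = coef a' b'"
  define F where "F i j k l = (y i * c j) * (y k * d l)" for i j k l
  have "(\<Sum>Z\<in>B. deriv1 Z (phi p v a b) x * deriv1 Z (phi p v a' b') x) =
      (\<Sum>Z\<in>B. pairing y Z c * pairing y Z d)"
    using orthonormal_basisD(2)[OF assms(1)] assms(2)
    by (intro sum.cong refl) (auto simp: deriv1_phi y_def c_def d_def)
  also have "\<dots> = (\<Sum>Z\<in>B. \<Sum>i\<in>UNIV. \<Sum>j\<in>UNIV. \<Sum>k\<in>UNIV. \<Sum>l\<in>UNIV. F i j k l * (Z $ i $ j * Z $ k $ l))"
    unfolding pairing_def sum_distrib_right unfolding sum_distrib_left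
    by (intro sum.cong refl) (simp add: F_def mult_ac)
  also have "\<dots> = (\<Sum>i\<in>UNIV. \<Sum>j\<in>UNIV. F i j (flip i) (flip j) * (qsign i * qsign j / 2)
      - F i j j i * (psign p i * psign p j / 2))"
    by (rule casimir_sum[OF assms(1)])
  also have "\<dots> = (\<Sum>i\<in>UNIV. \<Sum>j\<in>UNIV. (qsign i * y i * y (flip i)) * (qsign j * c j * d (flip j) / 2)
      - (y i * (psign p i * d i)) * (y j * (psign p j * c j)) / 2)"
    by (intro sum.cong refl) (simp add: F_def mult_ac)
  also have "\<dots> = (\<Sum>i\<in>UNIV. qsign i * y i * y (flip i)) * (\<Sum>j\<in>UNIV. qsign j * c j * d (flip j) / 2)
      - (\<Sum>i\<in>UNIV. y i * (psign p i * d i)) * (\<Sum>j\<in>UNIV. y j * (psign p j * c j)) / 2"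
    unfolding sum_product by (simp only: sum_subtractf sum_divide_distrib)
  also have "\<dots> = - (\<Sum>i\<in>UNIV. y i * (e' * d i)) * (\<Sum>j\<in>UNIV. y j * (e * c j)) / 2"
    unfolding qsign_antisymmetric c_def d_def a a' by simp
  also have "\<dots> = - (e * e' / 2) * (\<Sum>j\<in>UNIV. y j * c j) * (\<Sum>i\<in>UNIV. y i * d i)"
    by (simp only: mult.left_commute[of _ e] mult.left_commute[of _ e'] flip: sum_distrib_left)
      simp
  finally show ?thesis using assms(2) by (simp add: phi_eq y_def c_def d_def)
qed

text \<open>
  In \<open>y Z\<^sup>2 c\<^sup>t\<close> the two inner indices coincide. The first term of the Casimir tensor then
  forces \<open>j = flip i\<close> and leaves \<open>qsign i * qsign (flip i) = -1\<close>; the second leaves a free sum over \<open>j\<close>, the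
  trace of the Hermitian form.
\<close>
lemma sum_orthonormal_deriv2:
  fixes a b :: "complex^'n::{finite,linorder}"
  assumes "orthonormal_basis (Sp p) B" "x \<in> Sp p"
    and a: "\<And>j. psign p j * coef a b j = e * coef a b j"
  shows "(\<Sum>Z\<in>B. deriv2 Z (phi p v a b) x) =
    - ((1 + e * (\<Sum>j\<in>UNIV. psign p (j :: 'n + 'n))) / 2) * phi p v a b x"
proof -
  define y c where "y = row_comb v x" and "c = coef a b"
  define F where "F i j k l = y i * (if j = k then c l else 0)" for i j k l :: "'n + 'n"
  have "(\<Sum>Z\<in>B. deriv2 Z (phi p v a b) x) = (\<Sum>Z\<in>B. pairing y (Z ** Z) c)"
    using orthonormal_basisD(2)[OF assms(1)] assms(2)
    by (intro sum.cong refl) (auto simp: deriv2_phi y_def c_def)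
  also have "\<dots> = (\<Sum>Z\<in>B. \<Sum>i\<in>UNIV. \<Sum>j\<in>UNIV. \<Sum>k\<in>UNIV. \<Sum>l\<in>UNIV. F i j k l * (Z $ i $ j * Z $ k $ l))"
  proof (intro sum.cong refl)
    fix Z :: "complex^('n + 'n)^('n + 'n)"
    have "(\<Sum>k\<in>UNIV. \<Sum>l\<in>UNIV. F i j k l * (Z $ i $ j * Z $ k $ l)) =
        (\<Sum>l\<in>UNIV. y i * (Z $ i $ j * Z $ j $ l) * c l)" for i j
    proof -
      have "(\<Sum>k\<in>UNIV. \<Sum>l\<in>UNIV. F i j k l * (Z $ i $ j * Z $ k $ l)) =
          (\<Sum>k\<in>UNIV. if k = j then \<Sum>l\<in>UNIV. y i * (Z $ i $ j * Z $ k $ l) * c l else 0)"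
        by (intro sum.cong refl) (auto simp: F_def mult_ac)
      then show ?thesis by (simp only: sum.delta finite UNIV_I if_True)
    qed
    moreover have "pairing y (Z ** Z) c = (\<Sum>i\<in>UNIV. \<Sum>j\<in>UNIV. \<Sum>l\<in>UNIV. y i * (Z $ i $ j * Z $ j $ l) * c l)"
      unfolding pairing_def matrix_matrix_mult_def vec_lambda_beta sum_distrib_left sum_distrib_right
      by (intro sum.cong refl sum.swap)
    ultimately show "pairing y (Z ** Z) c =
        (\<Sum>i\<in>UNIV. \<Sum>j\<in>UNIV. \<Sum>k\<in>UNIV. \<Sum>l\<in>UNIV. F i j k l * (Z $ i $ j * Z $ k $ l))"
      by simp
  qed
  also have "\<dots> = (\<Sum>i\<in>UNIV. \<Sum>j\<in>UNIV. F i j (flip i) (flip j) * (qsign i * qsign j / 2)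
      - F i j j i * (psign p i * psign p j / 2))"
    by (rule casimir_sum[OF assms(1)])
  \<comment> \<open>\<open>F i j (flip i) (flip j)\<close> is nonzero only for \<open>j = flip i\<close>, and \<open>F i j j i\<close> is \<open>y i * c i\<close>.\<close>
  also have "\<dots> = (\<Sum>i\<in>UNIV. \<Sum>j\<in>UNIV. (if j = flip i then - (y i * c i) / 2 else 0)
      - y i * (psign p i * c i) * psign p j / 2)"
    by (intro sum.cong refl) (auto simp: F_def mult_ac)
  also have "\<dots> = - ((1 + e * (\<Sum>j\<in>UNIV. psign p (j :: 'n + 'n))) / 2) * (\<Sum>i\<in>UNIV. y i * c i)"
  proof -
    have "(\<Sum>i\<in>UNIV. \<Sum>j\<in>UNIV. y i * (psign p i * c i) * psign p (j :: 'n + 'n) / 2) =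
        (\<Sum>i\<in>UNIV. y i * (e * c i)) * (\<Sum>j\<in>UNIV. psign p (j :: 'n + 'n)) / 2"
      unfolding sum_product sum_divide_distrib c_def a by (rule refl)
    also have "(\<Sum>i\<in>UNIV. y i * (e * c i)) = e * (\<Sum>i\<in>UNIV. y i * c i)"
      by (simp only: mult.left_commute[of _ e] flip: sum_distrib_left)
    finally show ?thesis
      by (simp add: sum_subtractf sum_negf flip: sum_divide_distrib) (simp add: field_simps)
  qed
  finally show ?thesis using assms(2) by (simp add: phi_eq y_def c_def)
qed

text \<open>
  The definite description is resolved by the existence of an orthonormal basis and the
  basis independence of the sum.
\<close>
lemma kappa_phi:
  fixes a b a' b' :: "complex^'n::{finite,linorder}"
  assumes "x \<in> Sp p"
    and "\<And>j. psign p j * coef a b j = e * coef a b j"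
    and "\<And>j. psign p j * coef a' b' j = e' * coef a' b' j"
  shows "kappa (Sp p) (phi p v a b) (phi p v a' b') x =
    - (e * e' / 2) * phi p v a b x * phi p v a' b' x"
  unfolding kappa_def
proof (rule the_equality)
  show "\<forall>B. orthonormal_basis (Sp p) B \<longrightarrow> - (e * e' / 2) * phi p v a b x * phi p v a' b' x =
      (\<Sum>Z\<in>B. deriv1 Z (phi p v a b) x * deriv1 Z (phi p v a' b') x)"
    using sum_orthonormal_deriv1[OF _ assms] by simp
  show "c = - (e * e' / 2) * phi p v a b x * phi p v a' b' x"
    if "\<forall>B. orthonormal_basis (Sp p) B \<longrightarrow>
      c = (\<Sum>Z\<in>B. deriv1 Z (phi p v a b) x * deriv1 Z (phi p v a' b') x)" for c
  proof -
    obtain B :: "(complex^('n + 'n)^('n + 'n)) set" where B: "orthonormal_basis (Sp p) B"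
      using orthonormal_basis_exists by blast
    show ?thesis using that B sum_orthonormal_deriv1[OF B assms] by simp
  qed
qed

lemma tau_phi:
  fixes a b :: "complex^'n::{finite,linorder}"
  assumes "x \<in> Sp p" and "\<And>j. psign p j * coef a b j = e * coef a b j"
  shows "tau (Sp p) (phi p v a b) x =
    - ((1 + e * (\<Sum>j\<in>UNIV. psign p (j :: 'n + 'n))) / 2) * phi p v a b x" (is "_ = ?r")
  unfolding tau_def
proof (rule the_equality)
  show "\<forall>B. orthonormal_basis (Sp p) B \<longrightarrow> ?r = (\<Sum>Z\<in>B. deriv2 Z (phi p v a b) x)"
    using sum_orthonormal_deriv2[OF _ assms] by simp
  show "c = ?r"
    if "\<forall>B. orthonormal_basis (Sp p) B \<longrightarrow> c = (\<Sum>Z\<in>B. deriv2 Z (phi p v a b) x)" for c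
  proof -
    obtain B :: "(complex^('n + 'n)^('n + 'n)) set" where B: "orthonormal_basis (Sp p) B"
      using orthonormal_basis_exists by blast
    show ?thesis using that B sum_orthonormal_deriv2[OF B assms] by simp
  qed
qed

lemma psign_coef_Cp1:
  assumes "a \<in> Cp1 p" "b \<in> Cp1 p"
  shows "psign p j * coef a b j = - 1 * coef a b j"
  using assms by (cases j) (auto simp: Cp1_def psign_def coef_def I_pq_def not_less)

lemma psign_coef_Cq2:
  assumes "a \<in> Cq2 p" "b \<in> Cq2 p"
  shows "psign p j * coef a b j = 1 * coef a b j"
  using assms by (cases j) (auto simp: Cq2_def psign_def coef_def I_pq_def)

lemma eigenfamily_phi:
  fixes S :: "(complex^'n::{finite,linorder}) set"
  assumes S: "\<And>a b j. a \<in> S \<Longrightarrow> b \<in> S \<Longrightarrow> psign p j * coef a b j = e * coef a b j"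
  shows "eigenfamily (Sp p) {phi p v a b | a b. a \<in> S \<and> b \<in> S}"
proof -
  let ?l = "- ((1 + e * (\<Sum>j\<in>UNIV. psign p (j :: 'n + 'n))) / 2)"
  have "tau (Sp p) \<phi> x = ?l * \<phi> x \<and> kappa (Sp p) \<phi> \<psi> x = - (e * e / 2) * \<phi> x * \<psi> x"
    if fam: "\<phi> \<in> {phi p v a b | a b. a \<in> S \<and> b \<in> S}" "\<psi> \<in> {phi p v a b | a b. a \<in> S \<and> b \<in> S}"
      and x: "x \<in> Sp p" for \<phi> \<psi> x
  proof -
    obtain a b a' b' where "\<phi> = phi p v a b" "\<psi> = phi p v a' b'" "a \<in> S" "b \<in> S" "a' \<in> S" "b' \<in> S"
      using fam by blast
    then show ?thesis using tau_phi[OF x S] kappa_phi[OF x S S] by blast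
  qed
  then show ?thesis unfolding eigenfamily_def by blast
qed

lemma subspace_phi:
  assumes S: "0 \<in> S" "\<And>a b. a \<in> S \<Longrightarrow> b \<in> S \<Longrightarrow> a + b \<in> S" "\<And>c a. a \<in> S \<Longrightarrow> c *s a \<in> S"
  shows "module.subspace (\<lambda>(c::complex) \<phi> x. c * \<phi> x) {phi p v a b | a b. a \<in> S \<and> b \<in> S}"
proof -
  interpret module "\<lambda>(c::complex) (\<phi> :: complex^('n::{finite,linorder} + 'n)^('n + 'n) \<Rightarrow> complex) x. c * \<phi> x"
    by standard (auto simp: fun_eq_iff algebra_simps)
  have out: "phi p v a b g = 0" if "g \<notin> Sp p" for a b g using that by (simp add: phi_def)
  have coef: "coef 0 0 j = 0" "coef (a + a') (b + b') j = coef a b j + coef a' b' j"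
    "coef (c *s a) (c *s b) j = c * coef a b j" for a a' b b' c j
    by (cases j; simp add: coef_def)+
  have zero: "phi p v 0 0 = 0"
  proof
    show "phi p v 0 0 g = 0 g" for g
      by (cases "g \<in> Sp p") (simp_all add: out phi_eq coef)
  qed
  have add: "phi p v a b + phi p v a' b' = phi p v (a + a') (b + b')" for a a' b b'
  proof
    show "(phi p v a b + phi p v a' b') g = phi p v (a + a') (b + b') g" for g
      by (cases "g \<in> Sp p") (simp_all add: out phi_eq coef distrib_left sum.distrib)
  qed
  have scale: "(\<lambda>g. c * phi p v a b g) = phi p v (c *s a) (c *s b)" for c a b
  proof
    show "c * phi p v a b g = phi p v (c *s a) (c *s b) g" for g
      by (cases "g \<in> Sp p") (simp_all add: out phi_eq coef sum_distrib_left mult_ac)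
  qed
  show ?thesis
  proof (rule subspaceI)
    show "0 \<in> {phi p v a b | a b. a \<in> S \<and> b \<in> S}" using zero S(1) by force
  qed (use S add scale in \<open>auto; blast\<close>)+
qed

theorem theorem12p2:
  fixes p q :: nat and v :: "complex^'n::{finite,linorder}"
  assumes "CARD('n) = p + q" and "v \<noteq> 0"
  shows "module.subspace (\<lambda>(c::complex) \<phi> x. c * \<phi> x) (family1 p v) \<and>
         module.subspace (\<lambda>(c::complex) \<phi> x. c * \<phi> x) (family2 p v) \<and>
         eigenfamily (Sp p) (family1 p v) \<and>
         eigenfamily (Sp p) (family2 p v) \<and>
         bi_eigenfamily (Sp p) (family1 p v) (family2 p v)"
proof -
  have sub: "module.subspace (\<lambda>(c::complex) \<phi> x. c * \<phi> x) (family1 p v)"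
    "module.subspace (\<lambda>(c::complex) \<phi> x. c * \<phi> x) (family2 p v)"
    unfolding family1_def family2_def by (rule subspace_phi; simp add: Cp1_def Cq2_def)+
  have ne: "family1 p v \<noteq> {}" "family2 p v \<noteq> {}"
    by (auto simp: family1_def family2_def Cp1_def Cq2_def intro!: exI[of _ 0])
  have ef: "eigenfamily (Sp p) (family1 p v)" "eigenfamily (Sp p) (family2 p v)"
    unfolding family1_def family2_def
    by (rule eigenfamily_phi, erule psign_coef_Cp1, assumption)
       (rule eigenfamily_phi, erule psign_coef_Cq2, assumption)
  have "\<exists>\<mu>. \<forall>\<phi>\<in>family1 p v. \<forall>\<psi>\<in>family2 p v. \<forall>x\<in>Sp p. kappa (Sp p) \<phi> \<psi> x = \<mu> * \<phi> x * \<psi> x"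
  proof -
    have "kappa (Sp p) \<phi> \<psi> x = - (- 1 * 1 / 2) * \<phi> x * \<psi> x"
      if "\<phi> \<in> family1 p v" "\<psi> \<in> family2 p v" "x \<in> Sp p" for \<phi> \<psi> x
      using that kappa_phi[OF _ psign_coef_Cp1 psign_coef_Cq2]
      by (auto simp: family1_def family2_def)
    then show ?thesis by blast
  qed
  then show ?thesis using sub ne ef by (simp add: bi_eigenfamily_def)
qed

end
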